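(* There exists a perfect $1$-error-correcting code in the Cartesian product $C_6 \square C_6 \square C_2$.
   Context: All graphs are simple; $d(x,y)$ is the shortest-path distance. $C_6$ is the cycle on $6$ vertices and, by convention, $C_2$ is a single edge ($K_2$). The Cartesian product $G\square H$ has vertex set $V(G)\times V(H)$, with $(g_1,h_1)$ adjacent to $(g_2,h_2)$ iff either $h_1=h_2$ and $g_1g_2\in E(G)$, or $g_1=g_2$ and $h_1h_2\in E(H)$. A code is a subset $D$ of the vertex set; it is a perfect $1$-error-correcting code if any two distinct codewords are at distance at least $3$ and every vertex is at distance at most $1$ from some codeword. *)

theory Defs
  imports "Graph_Theory.Pair_Digraph" "Graph_Theory.Shortest_Path"
begin

text \<open>
  A finite simple graph is a \<^locale>\<open>pair_graph\<close>: an undirected edge \<open>uv\<close> is the pair of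
  arcs \<open>(u, v)\<close>, \<open>(v, u)\<close>.
\<close>

text \<open>
  Intended for \<open>n \<ge> 2\<close>. For \<open>n = 2\<close> the two disjuncts coincide, which yields the
  single edge $K_2$.
\<close>
definition cycle_graph :: "nat \<Rightarrow> nat pair_pre_digraph" where
  "cycle_graph n =
    \<lparr> pverts = {..<n},
      parcs = {(i, j). i < n \<and> j < n \<and> (j = Suc i mod n \<or> i = Suc j mod n)} \<rparr>"

definition cartesian_product ::
  "'a pair_pre_digraph \<Rightarrow> 'b pair_pre_digraph \<Rightarrow> ('a \<times> 'b) pair_pre_digraph"
  (infixl \<open>\<box>\<close> 70) where
  "G \<box> H =
    \<lparr> pverts = pverts G \<times> pverts H,
      parcs = {((g1, h1), (g2, h2)).
        (h1 = h2 \<and> h1 \<in> pverts H \<and> (g1, g2) \<in> parcs G) \<or>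
        (g1 = g2 \<and> g1 \<in> pverts G \<and> (h1, h2) \<in> parcs H)} \<rparr>"

text \<open>The distance is \<open>\<infinity>\<close> for vertices in different components.\<close>
definition graph_dist :: "'a pair_pre_digraph \<Rightarrow> 'a \<Rightarrow> 'a \<Rightarrow> ereal" where
  "graph_dist G = wf_digraph.\<mu> (with_proj G) (\<lambda>_. 1)"

definition perfect_1_code :: "'a pair_pre_digraph \<Rightarrow> 'a set \<Rightarrow> bool" where
  "perfect_1_code G D \<longleftrightarrow>
     D \<subseteq> pverts G \<and>
     (\<forall>x\<in>D. \<forall>y\<in>D. x \<noteq> y \<longrightarrow> 3 \<le> graph_dist G x y) \<and>
     (\<forall>v\<in>pverts G. \<exists>x\<in>D. graph_dist G v x \<le> 1)"

lemma pair_graph_cycle_graph: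
  assumes "2 \<le> n"
  shows "pair_graph (cycle_graph n)"
proof -
  have "finite {(i, j). i < n \<and> j < n \<and> (j = Suc i mod n \<or> i = Suc j mod n)}"
    by (rule finite_subset[of _ "{..<n} \<times> {..<n}"]) auto
  moreover have "Suc i mod n \<noteq> i" "i \<noteq> Suc i mod n" if "i < n" for i
    using that assms by (cases "Suc i = n"; auto)+
  ultimately show ?thesis
    by unfold_locales (auto simp: cycle_graph_def symmetric_def intro: symI)
qed

lemma parcs_cycle_graph_2: "parcs (cycle_graph 2) = {(0, 1), (1, 0)}"
  by (auto simp: cycle_graph_def less_2_cases_iff)

lemma pair_graph_cartesian_product:
  assumes "pair_graph G" and "pair_graph H"
  shows "pair_graph (G \<box> H)"
proof -
  interpret G: pair_graph G by fact
  interpret H: pair_graph H by fact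
  have sub: "parcs (G \<box> H) \<subseteq> (pverts G \<times> pverts H) \<times> (pverts G \<times> pverts H)"
    by (auto simp: cartesian_product_def dest: G.wellformed' H.wellformed')
  have fin: "finite (parcs (G \<box> H))"
    by (rule finite_subset[OF sub])
      (simp add: G.pair_finite_verts H.pair_finite_verts)
  have symG: "sym (parcs G)" and symH: "sym (parcs H)"
    using G.pair_sym_arcs H.pair_sym_arcs by (auto simp: symmetric_def)
  have sym: "sym (parcs (G \<box> H))"
    by (rule symI) (auto simp: cartesian_product_def dest: symD[OF symG] symD[OF symH])
  have loopfree: "fst e \<noteq> snd e" if "e \<in> parcs (G \<box> H)" for e
    using that by (auto simp: cartesian_product_def dest: G.pair_no_loops H.pair_no_loops)
  have verts: "pverts (G \<box> H) = pverts G \<times> pverts H"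
    by (simp add: cartesian_product_def)
  show ?thesis
  proof
    show "fst e \<in> pverts (G \<box> H)" "snd e \<in> pverts (G \<box> H)" if "e \<in> parcs (G \<box> H)" for e
      using that sub by (auto simp: verts)
    show "finite (pverts (G \<box> H))"
      by (simp add: verts G.pair_finite_verts H.pair_finite_verts)
  qed (use fin sym loopfree in \<open>auto simp: symmetric_def\<close>)
qed

end

theory Submission
  imports Defs "HOL-Library.Numeral_Type"
begin

text \<open>
  The code is the kernel of the homomorphism \<open>(x, y, z) \<mapsto> x + 2y + 3z\<close> from
  \<open>\<int>\<^sub>6 \<times> \<int>\<^sub>6 \<times> \<int>\<^sub>2\<close> to \<open>\<int>\<^sub>6\<close>. The five unit steps \<open>\<plusminus>e\<^sub>1\<close>, \<open>\<plusminus>e\<^sub>2\<close>, \<open>e\<^sub>3\<close> are sent to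
  \<open>\<plusminus>1\<close>, \<open>\<plusminus>2\<close>, \<open>3\<close>, so on every ball of radius 1 the homomorphism is a bijection onto
  \<open>\<int>\<^sub>6\<close>, and each ball contains exactly one codeword.
\<close>

lemma (in pair_wf_digraph) graph_dist_eq_INF_length:
  "graph_dist G u v = (INF p\<in>{p. awalk u p v}. ereal (length p))"
proof -
  have "awalk_cost (\<lambda>_. 1) p = length p" for p
    by (induction p) simp_all
  then show ?thesis
    by (simp add: graph_dist_def \<mu>_def)
qed

lemma (in pair_wf_digraph) graph_dist_le_length:
  assumes "awalk u p v"
  shows "graph_dist G u v \<le> length p"
  unfolding graph_dist_eq_INF_length using assms by (auto intro: INF_lower2)

lemma (in pair_wf_digraph) graph_dist_geI:
  assumes "\<And>p. awalk u p v \<Longrightarrow> n \<le> length p"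
  shows "n \<le> graph_dist G u v"
  unfolding graph_dist_eq_INF_length using assms by (auto intro: INF_greatest)

definition out_neighbours :: "'a pair_pre_digraph \<Rightarrow> 'a \<Rightarrow> 'a set" where
  "out_neighbours G v = {w. (v, w) \<in> parcs G}"

definition closed_neighbourhood :: "'a pair_pre_digraph \<Rightarrow> 'a \<Rightarrow> 'a set" where
  "closed_neighbourhood G v = insert v (out_neighbours G v)"

lemma (in pair_wf_digraph) closed_neighbourhood_subset_pverts:
  assumes "v \<in> pverts G"
  shows "closed_neighbourhood G v \<subseteq> pverts G"
  using assms by (auto simp: closed_neighbourhood_def out_neighbours_def dest: in_arcsD2)

lemma (in pair_sym_digraph) closed_neighbourhood_sym:
  assumes "w \<in> closed_neighbourhood G v"
  shows "v \<in> closed_neighbourhood G w"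
  using assms by (auto simp: closed_neighbourhood_def out_neighbours_def intro: arcs_symmetric)

lemma (in pair_wf_digraph) graph_dist_le_1:
  assumes "v \<in> pverts G" and "w \<in> closed_neighbourhood G v"
  shows "graph_dist G v w \<le> 1"
proof (cases "w = v")
  case True
  with assms(1) have "awalk v [] w"
    by (simp add: awalk_Nil_iff)
  then have "graph_dist G v w \<le> length ([] :: ('a \<times> 'a) list)"
    by (rule graph_dist_le_length)
  also have "\<dots> \<le> 1"
    by simp
  finally show ?thesis .
next
  case False
  with assms(2) have "awalk v [(v, w)] w"
    by (auto simp: closed_neighbourhood_def out_neighbours_def awalk_simps dest: in_arcsD2)
  then show ?thesis
    using graph_dist_le_length[of v "[(v, w)]" w] by (simp add: one_ereal_def)
qed

lemma (in pair_sym_digraph) graph_dist_ge_3: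
  assumes disjoint: "closed_neighbourhood G u \<inter> closed_neighbourhood G v = {}"
  shows "3 \<le> graph_dist G u v"
proof -
  have "3 \<le> length p" if walk: "awalk u p v" for p
  proof (rule ccontr)
    assume "\<not> 3 \<le> length p"
    then consider (trivial) "p = []" | (arc) a where "p = [a]" | (two_arcs) a b where "p = [a, b]"
      by (cases p; cases "tl p"; cases "tl (tl p)") auto
    then have "\<exists>w. w \<in> closed_neighbourhood G u \<and> v \<in> closed_neighbourhood G w"
    proof cases
      case trivial
      with walk show ?thesis
        by (auto simp: closed_neighbourhood_def awalk_simps)
    next
      case (arc a)
      with walk show ?thesis
        by (cases a) (auto simp: closed_neighbourhood_def out_neighbours_def awalk_simps)
    next
      case (two_arcs a b)
      with walk show ?thesis
        by (cases a; cases b) (auto simp: closed_neighbourhood_def out_neighbours_def awalk_simps)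
    qed
    then show False
      using disjoint closed_neighbourhood_sym by blast
  qed
  then show ?thesis
    using graph_dist_geI[of u v 3] by simp
qed

lemma (in pair_sym_digraph) perfect_1_codeI:
  assumes "D \<subseteq> pverts G"
    and unique: "\<And>v. v \<in> pverts G \<Longrightarrow> \<exists>!c. c \<in> D \<inter> closed_neighbourhood G v"
  shows "perfect_1_code G D"
  unfolding perfect_1_code_def
proof (intro conjI ballI impI)
  fix x y
  assume xy: "x \<in> D" "y \<in> D" "x \<noteq> y"
  show "3 \<le> graph_dist G x y"
  proof (rule graph_dist_ge_3, rule equals0I)
    fix w
    assume w: "w \<in> closed_neighbourhood G x \<inter> closed_neighbourhood G y"
    then have "x \<in> closed_neighbourhood G w" "y \<in> closed_neighbourhood G w"
      by (simp_all add: closed_neighbourhood_sym)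
    moreover have "w \<in> pverts G"
      using w \<open>x \<in> D\<close> \<open>D \<subseteq> pverts G\<close> closed_neighbourhood_subset_pverts by blast
    ultimately show False
      using unique xy by blast
  qed
next
  show "\<exists>c\<in>D. graph_dist G v c \<le> 1" if "v \<in> pverts G" for v
    using unique[OF that] graph_dist_le_1[OF that] by blast
qed fact

definition displacement_labelling ::
  "'a pair_pre_digraph \<Rightarrow> 'b::ab_group_add set \<Rightarrow> ('a \<Rightarrow> 'b) \<Rightarrow> bool" where
  "displacement_labelling G S f \<longleftrightarrow>
     (\<forall>v\<in>pverts G. bij_betw (\<lambda>w. f w - f v) (out_neighbours G v) S)"

lemma displacement_labelling_bij_betw_closed_neighbourhood:
  assumes "displacement_labelling G (UNIV - {0}) f" and "v \<in> pverts G"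
  shows "bij_betw f (closed_neighbourhood G v) UNIV"
proof -
  have "bij_betw (\<lambda>w. f w - f v) (out_neighbours G v) (UNIV - {0})"
    using assms by (simp add: displacement_labelling_def)
  then have "bij_betw (\<lambda>w. f w - f v) ({v} \<union> out_neighbours G v) ({0} \<union> (UNIV - {0}))"
    by (intro bij_betw_combine) auto
  then have "bij_betw (\<lambda>w. f w - f v) (closed_neighbourhood G v) UNIV"
    by (simp add: closed_neighbourhood_def)
  then have "bij_betw ((+) (f v) \<circ> (\<lambda>w. f w - f v)) (closed_neighbourhood G v) UNIV"
    by (rule bij_betw_trans) simp
  then show ?thesis
    by (simp add: o_def)
qed

lemma perfect_1_code_fibre:
  assumes "pair_sym_digraph G" and f: "displacement_labelling G (UNIV - {0}) f"
  shows "perfect_1_code G {v \<in> pverts G. f v = c}"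
proof -
  interpret pair_sym_digraph G by fact
  show ?thesis
  proof (rule perfect_1_codeI)
    fix v
    assume v: "v \<in> pverts G"
    have bij: "bij_betw f (closed_neighbourhood G v) UNIV"
      using f v by (rule displacement_labelling_bij_betw_closed_neighbourhood)
    then have "c \<in> f ` closed_neighbourhood G v"
      by (simp add: bij_betw_imp_surj_on)
    then obtain w where w: "w \<in> closed_neighbourhood G v" "f w = c"
      by blast
    show "\<exists>!w. w \<in> {v \<in> pverts G. f v = c} \<inter> closed_neighbourhood G v"
    proof (rule ex1I)
      show "w \<in> {v \<in> pverts G. f v = c} \<inter> closed_neighbourhood G v"
        using w closed_neighbourhood_subset_pverts[OF v] by blast
      show "w' = w" if "w' \<in> {v \<in> pverts G. f v = c} \<inter> closed_neighbourhood G v" for w'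
        using bij_betw_imp_inj_on[OF bij] w that by (auto dest: inj_onD)
    qed
  qed blast
qed

lemma out_neighbours_cartesian_product:
  assumes "v \<in> pverts (G \<box> H)"
  shows "out_neighbours (G \<box> H) v =
    (\<lambda>g. (g, snd v)) ` out_neighbours G (fst v) \<union> Pair (fst v) ` out_neighbours H (snd v)"
  using assms by (auto simp: out_neighbours_def cartesian_product_def)

lemma displacement_labelling_cartesian_product:
  assumes f: "displacement_labelling G S f" and g: "displacement_labelling H T g"
    and "S \<inter> T = {}"
  shows "displacement_labelling (G \<box> H) (S \<union> T) (\<lambda>(x, y). f x + g y)"
  unfolding displacement_labelling_def
proof
  fix v
  assume v: "v \<in> pverts (G \<box> H)"
  let ?disp = "\<lambda>w. (case w of (x, y) \<Rightarrow> f x + g y) - (case v of (x, y) \<Rightarrow> f x + g y)"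
  obtain x y where xy: "v = (x, y)" "x \<in> pverts G" "y \<in> pverts H"
    using v by (auto simp: cartesian_product_def)
  have "bij_betw ?disp ((\<lambda>x'. (x', y)) ` out_neighbours G x) S"
    using f xy by (simp add: displacement_labelling_def bij_betw_def inj_on_def image_image)
  moreover have "bij_betw ?disp (Pair x ` out_neighbours H y) T"
    using g xy by (simp add: displacement_labelling_def bij_betw_def inj_on_def image_image)
  ultimately show "bij_betw ?disp (out_neighbours (G \<box> H) v) (S \<union> T)"
    unfolding out_neighbours_cartesian_product[OF v] using \<open>S \<inter> T = {}\<close> xy
    by (simp add: bij_betw_combine)
qed

lemma out_neighbours_cycle_graph:
  assumes "i < n"
  shows "out_neighbours (cycle_graph n) i = {Suc i mod n, (i + n - 1) mod n}"
proof -
  have "i = Suc j mod n \<longleftrightarrow> j = (i + n - 1) mod n" if "j < n" for j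
    using that assms by (cases i; cases "Suc j = n") auto
  then show ?thesis
    using assms by (auto simp: out_neighbours_def cycle_graph_def)
qed

lemma displacement_labelling_cycle_graph:
  fixes k :: "'a::ring_1"
  assumes period: "of_nat n * k = 0" and "n = 2 \<or> k \<noteq> - k"
  shows "displacement_labelling (cycle_graph n) {k, - k} (\<lambda>i. of_nat i * k)"
  unfolding displacement_labelling_def
proof
  fix i
  assume "i \<in> pverts (cycle_graph n)"
  then have i: "i < n"
    by (simp add: cycle_graph_def)
  have label_mod: "of_nat (j mod n) * k = of_nat j * k" for j
  proof -
    have "of_nat j * k = of_nat (j div n) * (of_nat n * k) + of_nat (j mod n) * k"
      by (metis div_mult_mod_eq distrib_right mult.assoc of_nat_add of_nat_mult)
    then show ?thesis
      by (simp add: period)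
  qed
  have succ: "of_nat (Suc i mod n) * k - of_nat i * k = k"
    unfolding label_mod by (simp add: algebra_simps)
  have pred: "of_nat ((i + n - 1) mod n) * k - of_nat i * k = - k"
    unfolding label_mod using i period by (simp add: of_nat_diff algebra_simps)
  have "Suc i mod n = (i + n - 1) mod n" if "k = - k"
  proof -
    have "n = 2"
      using assms(2) that by simp
    then show ?thesis
      by simp
  qed
  then have "inj_on (\<lambda>j. of_nat j * k - of_nat i * k) {Suc i mod n, (i + n - 1) mod n}"
    using succ pred by (auto simp: inj_on_def)
  then show "bij_betw (\<lambda>j. of_nat j * k - of_nat i * k) (out_neighbours (cycle_graph n) i) {k, - k}"
    unfolding out_neighbours_cycle_graph[OF i] bij_betw_def
    by (simp add: succ pred del: One_nat_def)
qed

theorem theorem9: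
  shows "\<exists>D. perfect_1_code (cycle_graph 6 \<box> cycle_graph 6 \<box> cycle_graph 2) D"
proof -
  let ?G = "cycle_graph 6 \<box> cycle_graph 6 \<box> cycle_graph 2"
  let ?f = "\<lambda>(v, z). (\<lambda>(x, y). of_nat x * 1 + of_nat y * 2) v + of_nat z * (3 :: 6)"
  have "pair_graph ?G"
    by (intro pair_graph_cartesian_product pair_graph_cycle_graph) simp_all
  then have "pair_sym_digraph ?G"
    by (simp add: pair_graph_def pair_pseudo_graph_def)
  moreover have "(UNIV :: 6 set) = {0, 1, - 1, 2, - 2, 3}"
    by (rule card_seteq[symmetric]) simp_all
  then have "{1, - 1} \<union> {2, - 2} \<union> {3, - 3} = UNIV - {0 :: 6}"
    by auto
  moreover have "displacement_labelling ?G ({1, - 1} \<union> {2, - 2} \<union> {3, - 3}) ?f"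
    by (intro displacement_labelling_cartesian_product displacement_labelling_cycle_graph) simp_all
  ultimately have "perfect_1_code ?G {v \<in> pverts ?G. ?f v = 0}"
    by (intro perfect_1_code_fibre) simp_all
  then show ?thesis ..
qed

end
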